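(* Let $p$ be a prime, let $n>0$ be an integer, let $a\in \mathbb{F}_p[X]$ be a non-constant polynomial of degree at most $n-1$, and let $f_1,f_2\in\mathbb{F}_p[X]$ be monic irreducible polynomials of degree $n$. Then there exists an even integer $k>0$ such that the $k$-chain $(a_0,a_1,\ldots,a_k)$ of $a$ with respect to $(f_1,f_2)$ is a cycle of length $k$, that is, $a_k=a_0=a$ and $a_0,a_1,\ldots,a_{k-1}$ are all distinct polynomials. Moreover, if $f_1\neq f_2$, then this cycle has even length $k\ge 4$.
   Context: $\mathbb{F}_p=\mathbb{Z}/p\mathbb{Z}$. $\mathcal{P}(p,n)$ denotes the set of all polynomials in $\mathbb{F}_p[X]$ of degree at most $n-1$ (including $0$). For a monic irreducible polynomial $f\in\mathbb{F}_p[X]$ of degree $n$ and a non-zero $a\in\mathcal{P}(p,n)$, $\mathrm{inv}_f(a)\in\mathcal{P}(p,n)$ denotes the multiplicative inverse of $a$ with respect to $f$: the unique polynomial of degree at most $n-1$ with $a\cdot \mathrm{inv}_f(a)\equiv 1 \pmod{f}$. For an integer $k>0$, a non-zero $a\in\mathcal{P}(p,n)$ and irreducible polynomials $f_1,f_2\in\mathbb{F}_p[X]$ of degree $n$, the $k$-chain of $a$ with respect to $(f_1,f_2)$ is the sequence $(a_0,a_1,\ldots,a_k)$ defined by $a_0=a$, $a_i=\mathrm{inv}_{f_1}(a_{i-1})$ if $i$ is odd, and $a_i=\mathrm{inv}_{f_2}(a_{i-1})$ if $i\geq 2$ is even. *)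

theory Defs
  imports
    "Berlekamp_Zassenhaus.Finite_Field"
    "HOL-Computational_Algebra.Polynomial_Factorial"
    "HOL-Number_Theory.Cong"
begin

text \<open>
  The field of \<open>p\<close> elements is \<^typ>\<open>'p::prime_card mod_ring\<close>, the integers modulo
  \<open>p = CARD('p)\<close>; the class \<^class>\<open>prime_card\<close> says that this cardinality is prime.
\<close>

text \<open>
  Polynomials of degree at most \<open>n - 1\<close>. The zero polynomial has degree \<open>0\<close> in the
  library, so it is listed separately; this matters only for \<open>n = 0\<close>.
\<close>

definition polys_below :: "nat \<Rightarrow> 'p::prime_card mod_ring poly set" where
  "polys_below n = {g. g = 0 \<or> degree g < n}"

text \<open>
  Meaningful only for irreducible \<open>f\<close> and non-zero \<open>a \<in> polys_below (degree f)\<close>; in that case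
  the inverse exists and is unique, see \<open>ex1_inv_poly\<close> below.
\<close>

definition inv_poly :: "'p::prime_card mod_ring poly \<Rightarrow> 'p mod_ring poly \<Rightarrow> 'p mod_ring poly" where
  "inv_poly f a = (THE b. b \<in> polys_below (degree f) \<and> [a * b = 1] (mod f))"

lemma ex1_inv_poly:
  fixes f a :: "'p::prime_card mod_ring poly"
  assumes f: "irreducible f" and a: "a \<in> polys_below (degree f)" "a \<noteq> 0"
  shows "\<exists>!b. b \<in> polys_below (degree f) \<and> [a * b = 1] (mod f)"
proof (rule ex_ex1I)
  have ndvd: "\<not> f dvd a"
    using a by (auto simp: polys_below_def dest: dvd_imp_degree_le)
  have prime: "prime_elem f"
    using f by (rule field_poly_irreducible_imp_prime)
  have f0: "f \<noteq> 0"
    using f by auto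
  have "coprime a f"
    using prime_elem_imp_coprime[OF prime ndvd] by (simp add: coprime_commute)
  moreover obtain s t where "s * a + t * f = gcd a f"
    using bezout_coefficients_fst_snd by metis
  ultimately have "a * s + t * f = 1"
    by (simp add: mult.commute)
  then have "[a * (s mod f) = 1] (mod f)"
    by (metis cong_def mod_mult_right_eq mod_mult_self1)
  moreover have "s mod f \<in> polys_below (degree f)"
    using degree_mod_less[OF f0, of s] by (auto simp: polys_below_def)
  ultimately show "\<exists>b. b \<in> polys_below (degree f) \<and> [a * b = 1] (mod f)"
    by blast
  show "b = c"
    if b: "b \<in> polys_below (degree f) \<and> [a * b = 1] (mod f)"
      and c: "c \<in> polys_below (degree f) \<and> [a * c = 1] (mod f)" for b c
  proof (rule ccontr)
    assume "b \<noteq> c"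
    have "f dvd a * b - a * c"
      using b c by (metis cong_def mod_eq_dvd_iff)
    then have "f dvd a * (b - c)"
      by (simp add: right_diff_distrib)
    then have "f dvd b - c"
      using prime ndvd by (simp add: prime_elem_dvd_mult_iff)
    then have "degree f \<le> degree (b - c)"
      using \<open>b \<noteq> c\<close> by (intro dvd_imp_degree_le) auto
    moreover have "degree (b - c) < degree f"
      using b c \<open>b \<noteq> c\<close> degree_diff_less[of b "degree f" c]
      by (auto simp: polys_below_def)
    ultimately show False
      by simp
  qed
qed

text \<open>
  The \<open>k\<close>-chain of \<open>a\<close> is the initial segment \<open>inv_chain f1 f2 a 0, \<dots>, inv_chain f1 f2 a k\<close>.
\<close>

primrec inv_chain :: "'p::prime_card mod_ring poly \<Rightarrow> 'p mod_ring poly \<Rightarrow> 'p mod_ring poly \<Rightarrow> nat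
    \<Rightarrow> 'p mod_ring poly" where
  "inv_chain f1 f2 a 0 = a"
| "inv_chain f1 f2 a (Suc i) = inv_poly (if odd (Suc i) then f1 else f2) (inv_chain f1 f2 a i)"

end

theory Submission
  imports Defs
begin

text \<open>
  Inversion modulo an irreducible \<open>f\<close> of degree \<open>n\<close> is an involution of the finite set of
  non-constant polynomials of degree below \<open>n\<close>; the inverse of a non-constant polynomial is not a
  constant, because the non-zero constants are closed under inversion. The involution has no fixed
  point there: in the field \<open>F\<^sub>p[X]/(f)\<close> the equation \<open>b\<^sup>2 = 1\<close> forces \<open>b = \<plusminus>1\<close>, which is
  constant.

  The rest is a statement about any two fixed-point-free involutions of a finite set, applied
  alternately. A coincidence \<open>c i = c j\<close> at an odd distance can be folded inwards, since \<open>c (i + 1)\<close>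
  and \<open>c (j - 1)\<close> arise from the same point by the same involution; the folding ends at a
  fixed point (lemma \<open>alternating_neq_odd_gap\<close>). A coincidence at an even distance can be shifted
  back to \<open>c 0 = c (j - i)\<close> (lemma \<open>alternating_shift_even_gap\<close>). So the least positive return time \<open>k\<close>
  is even, and the terms before it are distinct.

  If \<open>k = 2\<close>, then \<open>a\<^sub>0 a\<^sub>1 - 1\<close> is divisible by \<open>f\<^sub>1\<close> and by \<open>f\<^sub>2\<close>. For distinct monic irreducible
  \<open>f\<^sub>1\<close> and \<open>f\<^sub>2\<close> it is then divisible by their product, of degree \<open>2n\<close>, although its own degree
  is below \<open>2n\<close>. Hence \<open>a\<^sub>0 a\<^sub>1 = 1\<close>, and \<open>a\<close> is constant, against the hypothesis.
\<close>

section \<open>Alternating two fixed-point-free involutions\<close>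

text \<open>
  The two involutions are \<open>h False\<close> and \<open>h True\<close>; step \<open>i\<close> uses \<open>h (odd i)\<close>.
\<close>

lemma alternating_neq_odd_gap:
  fixes c :: "nat \<Rightarrow> 'a" and h :: "bool \<Rightarrow> 'a \<Rightarrow> 'a"
  assumes c_Suc: "\<And>i. c (Suc i) = h (odd i) (c i)" and c_mem: "\<And>i. c i \<in> S"
    and inv: "\<And>b x. x \<in> S \<Longrightarrow> h b (h b x) = x"
    and nofix: "\<And>b x. x \<in> S \<Longrightarrow> h b x \<noteq> x"
  shows "c (i + 2 * d + 1) \<noteq> c i"
proof (induction d arbitrary: i)
  case 0
  show ?case
    using nofix[OF c_mem] by (simp add: c_Suc)
next
  case (Suc d)
  show ?case
  proof
    assume eq: "c (i + 2 * Suc d + 1) = c i"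
    have "c (i + 2 * Suc d + 1) = h (odd i) (c (Suc i + 2 * d + 1))"
      using c_Suc[of "Suc i + 2 * d + 1"] by simp
    then have "h (odd i) (c i) = c (Suc i + 2 * d + 1)"
      using eq inv[OF c_mem] by metis
    then show False
      using Suc.IH[of "Suc i"] by (simp add: c_Suc[of i])
  qed
qed

lemma alternating_shift_even_gap:
  fixes c :: "nat \<Rightarrow> 'a" and h :: "bool \<Rightarrow> 'a \<Rightarrow> 'a"
  assumes c_Suc: "\<And>i. c (Suc i) = h (odd i) (c i)" and c_mem: "\<And>i. c i \<in> S"
    and inv: "\<And>b x. x \<in> S \<Longrightarrow> h b (h b x) = x"
    and "even d" and "c (i + d) = c i"
  shows "c d = c 0"
  using \<open>c (i + d) = c i\<close>
proof (induction i)
  case 0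
  then show ?case by simp
next
  case (Suc i)
  have "h (odd i) (c (i + d)) = h (odd i) (c i)"
    using Suc.prems c_Suc[of "i + d"] c_Suc[of i] \<open>even d\<close> by simp
  then have "c (i + d) = c i"
    using inv[OF c_mem] by metis
  then show ?case
    by (rule Suc.IH)
qed

lemma alternating_involutions_even_cycle:
  fixes c :: "nat \<Rightarrow> 'a" and h :: "bool \<Rightarrow> 'a \<Rightarrow> 'a"
  assumes c_Suc: "\<And>i. c (Suc i) = h (odd i) (c i)" and c_mem: "\<And>i. c i \<in> S"
    and "finite S"
    and inv: "\<And>b x. x \<in> S \<Longrightarrow> h b (h b x) = x"
    and nofix: "\<And>b x. x \<in> S \<Longrightarrow> h b x \<noteq> x"
  shows "\<exists>k>0. even k \<and> c k = c 0 \<and> inj_on c {0..<k}"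
proof -
  have even_gap: "even (j - i)" if "c i = c j" "i < j" for i j
  proof (rule ccontr)
    assume "odd (j - i)"
    then obtain d where "j - i = 2 * d + 1"
      by (rule oddE)
    then have "j = i + 2 * d + 1"
      using \<open>i < j\<close> by simp
    then show False
      using alternating_neq_odd_gap[of c h S, OF c_Suc c_mem inv nofix] that by metis
  qed
  have return: "c (j - i) = c 0" if "c i = c j" "i < j" for i j
  proof (rule alternating_shift_even_gap[of c h S, OF c_Suc c_mem inv even_gap[OF that]])
    show "c (i + (j - i)) = c i"
      using that by simp
  qed
  define k where "k = (LEAST k. k > 0 \<and> c k = c 0)"
  have "\<not> inj c"
    using \<open>finite S\<close> c_mem finite_subset[of "range c" S] finite_imageD[of c UNIV] by auto
  then obtain i j where "i < j" "c i = c j"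
    by (metis injI linorder_neqE_nat)
  then have "0 < j - i \<and> c (j - i) = c 0"
    using return by simp
  then have k: "k > 0" "c k = c 0"
    unfolding k_def by (metis (mono_tags, lifting) LeastI)+
  have minimal: "c m \<noteq> c 0" if "0 < m" "m < k" for m
    using that not_less_Least[of m "\<lambda>k. k > 0 \<and> c k = c 0"] unfolding k_def by blast
  have "inj_on c {0..<k}"
  proof (rule linorder_inj_onI)
    fix i j assume "i < j" "i \<in> {0..<k}" "j \<in> {0..<k}"
    then show "c i \<noteq> c j"
      using return[of i j] minimal[of "j - i"] by auto
  qed auto
  moreover have "even k"
    using even_gap[of 0 k] k by simp
  ultimately show ?thesis
    using k by blast
qed

section \<open>Inversion modulo an irreducible polynomial\<close>

lemma finite_polys_below: "finite (polys_below n :: 'p::prime_card mod_ring poly set)"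
proof (rule finite_subset)
  show "polys_below n \<subseteq> Poly ` {xs :: 'p mod_ring list. set xs \<subseteq> UNIV \<and> length xs \<le> n}"
  proof
    fix g :: "'p mod_ring poly"
    assume "g \<in> polys_below n"
    then have "length (coeffs g) \<le> n"
      by (cases "g = 0") (auto simp: polys_below_def length_coeffs_degree)
    then show "g \<in> Poly ` {xs. set xs \<subseteq> UNIV \<and> length xs \<le> n}"
      by (intro image_eqI[of _ _ "coeffs g"]) auto
  qed
  show "finite (Poly ` {xs :: 'p mod_ring list. set xs \<subseteq> UNIV \<and> length xs \<le> n})"
    by (intro finite_imageI finite_lists_length_le) simp
qed

lemma inv_poly:
  assumes "irreducible f" "a \<in> polys_below (degree f)" "a \<noteq> 0"
  shows "inv_poly f a \<in> polys_below (degree f)" "[a * inv_poly f a = 1] (mod f)"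
  using theI'[OF ex1_inv_poly[OF assms]] unfolding inv_poly_def by simp_all

lemma inv_poly_eqI:
  assumes "irreducible f" "a \<in> polys_below (degree f)" "a \<noteq> 0"
    and "b \<in> polys_below (degree f)" "[a * b = 1] (mod f)"
  shows "inv_poly f a = b"
  unfolding inv_poly_def using assms by (intro the1_equality ex1_inv_poly) auto

lemma degree_inv_poly_pos:
  assumes f: "irreducible f" and a: "a \<in> polys_below (degree f)" "degree a > 0"
  shows "degree (inv_poly f a) > 0"
proof (rule ccontr)
  assume "\<not> degree (inv_poly f a) > 0"
  then obtain c where c: "inv_poly f a = [:c:]"
    by (metis degree_eq_zeroE gr0I)
  have "a \<noteq> 0" and less: "degree a < degree f"
    using a by (auto simp: polys_below_def)
  have "f dvd smult c a - 1"
    using inv_poly(2)[OF f a(1) \<open>a \<noteq> 0\<close>] c by (simp add: cong_iff_dvd_diff)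
  moreover have "degree (smult c a - 1) < degree f"
    using less by (intro degree_diff_less) auto
  ultimately have "smult c a = 1"
    using dvd_imp_degree_le[of f "smult c a - 1"] by force
  then show False
    using a(2) by (cases "c = 0") (auto dest: arg_cong[of _ _ degree])
qed

lemma inv_poly_inv_poly:
  assumes f: "irreducible f" and a: "a \<in> polys_below (degree f)" "degree a > 0"
  shows "inv_poly f (inv_poly f a) = a"
proof -
  have "a \<noteq> 0"
    using a by auto
  have "inv_poly f a \<noteq> 0"
    using degree_inv_poly_pos[OF f a] by auto
  then show ?thesis
    using inv_poly[OF f a(1) \<open>a \<noteq> 0\<close>] f a(1) by (intro inv_poly_eqI) (simp_all add: mult.commute)
qed

lemma inv_poly_neq:
  assumes f: "irreducible f" and a: "a \<in> polys_below (degree f)" "degree a > 0"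
  shows "inv_poly f a \<noteq> a"
proof
  assume eq: "inv_poly f a = a"
  have "a \<noteq> 0" and less: "degree a < degree f"
    using a by (auto simp: polys_below_def)
  have "f dvd a * a - 1"
    using inv_poly(2)[OF f a(1) \<open>a \<noteq> 0\<close>] eq by (simp add: cong_iff_dvd_diff)
  then have "f dvd (a - 1) * (a + 1)"
    by (simp add: algebra_simps)
  then have "f dvd a - 1 \<or> f dvd a + 1"
    using field_poly_irreducible_imp_prime[OF f] by (simp add: prime_elem_dvd_mult_iff)
  moreover have "degree (a - 1) < degree f" "degree (a + 1) < degree f"
    using less by (auto intro!: degree_diff_less degree_add_less)
  ultimately have "a = 1 \<or> a = - 1"
    using dvd_imp_degree_le[of f "a - 1"] dvd_imp_degree_le[of f "a + 1"]
    by (force simp: eq_neg_iff_add_eq_0)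
  then show False
    using a(2) by auto
qed

text \<open>The two inverses of \<open>a\<close> differ, so a chain for distinct moduli never closes after two steps.\<close>

lemma inv_poly_neq_inv_poly:
  fixes f g a :: "'p::prime_card mod_ring poly"
  assumes f: "irreducible f" "lead_coeff f = 1" and g: "irreducible g" "lead_coeff g = 1"
    and deg: "degree g = degree f" and "f \<noteq> g"
    and a: "a \<in> polys_below (degree f)" "degree a > 0"
  shows "inv_poly f a \<noteq> inv_poly g a"
proof
  define b where "b = inv_poly f a"
  assume "inv_poly f a = inv_poly g a"
  then have b_eq: "inv_poly g a = b"
    by (simp add: b_def)
  have "a \<noteq> 0" and less: "degree a < degree f"
    using a by (auto simp: polys_below_def)
  have "degree b < degree f"
    using inv_poly(1)[OF f(1) a(1) \<open>a \<noteq> 0\<close>] degree_inv_poly_pos[OF f(1) a]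
    by (auto simp: b_def polys_below_def)
  have "f dvd a * b - 1"
    using inv_poly(2)[OF f(1) a(1) \<open>a \<noteq> 0\<close>] by (simp add: b_def cong_iff_dvd_diff)
  moreover have "g dvd a * b - 1"
    using inv_poly(2)[OF g(1) _ \<open>a \<noteq> 0\<close>] a(1) deg by (simp add: b_eq cong_iff_dvd_diff)
  moreover have "coprime f g"
  proof (rule prime_elem_imp_coprime[OF field_poly_irreducible_imp_prime[OF f(1)]])
    show "\<not> f dvd g"
    proof
      assume "f dvd g"
      then obtain q where q: "g = f * q" ..
      have "g \<noteq> 0"
        using g(2) by auto
      \<comment> \<open>Equal degrees make the quotient a constant, and the leading coefficients make it 1.\<close>
      then have "degree q = 0"
        using q deg by (auto simp: degree_mult_eq)
      moreover have "lead_coeff q = 1"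
        using q f(2) g(2) by (simp add: lead_coeff_mult)
      ultimately have "q = 1"
        by (metis monic_degree_0)
      then show False
        using q \<open>f \<noteq> g\<close> by simp
    qed
  qed
  ultimately have dvd: "f * g dvd a * b - 1"
    by (simp add: divides_mult)
  have "degree (a * b - 1) < degree f + degree f"
    using less \<open>degree b < degree f\<close> degree_mult_le[of a b] by (intro degree_diff_less) auto
  moreover have "degree (f * g) = degree f + degree f"
    using f(2) g(2) deg by (subst degree_mult_eq) auto
  ultimately have "a * b = 1"
    using dvd_imp_degree_le[OF dvd] by force
  then have "a dvd 1"
    by (metis dvdI)
  then show False
    using a(2) by (auto simp: is_unit_iff_degree[OF \<open>a \<noteq> 0\<close>])
qed

section \<open>The cycle of a chain\<close>

theorem theorem1:
  fixes n :: nat and a f1 f2 :: "'p::prime_card mod_ring poly"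
  assumes "n > 0"
    and "a \<in> polys_below n" and "degree a > 0"
    and "irreducible f1" and "lead_coeff f1 = 1" and "degree f1 = n"
    and "irreducible f2" and "lead_coeff f2 = 1" and "degree f2 = n"
  shows "\<exists>k. even k \<and> k > 0 \<and> inv_chain f1 f2 a k = a
              \<and> inj_on (inv_chain f1 f2 a) {0..<k}
              \<and> (f1 \<noteq> f2 \<longrightarrow> k \<ge> 4)"
proof -
  define S :: "'p mod_ring poly set" where "S = {g \<in> polys_below n. degree g > 0}"
  define m where "m = (\<lambda>b. if b then f2 else f1)"
  have m: "irreducible (m b)" "degree (m b) = n" for b
    using assms by (auto simp: m_def)
  have inv_mem: "inv_poly (m b) g \<in> S" if "g \<in> S" for b g
    using that inv_poly(1)[OF m(1), of g b] degree_inv_poly_pos[OF m(1), of g b]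
    by (cases "g = 0") (auto simp: S_def m(2))
  have chain_Suc: "inv_chain f1 f2 a (Suc i) = inv_poly (m (odd i)) (inv_chain f1 f2 a i)" for i
    by (simp add: m_def)
  have chain_mem: "inv_chain f1 f2 a i \<in> S" for i
  proof (induction i)
    case 0
    show ?case
      using assms by (simp add: S_def)
  next
    case (Suc i)
    then show ?case
      unfolding chain_Suc by (rule inv_mem)
  qed
  have "\<exists>k>0. even k \<and> inv_chain f1 f2 a k = inv_chain f1 f2 a 0
      \<and> inj_on (inv_chain f1 f2 a) {0..<k}"
  proof (rule alternating_involutions_even_cycle[where h = "\<lambda>b. inv_poly (m b)" and S = S])
    show "finite S"
      unfolding S_def by (rule finite_subset[OF _ finite_polys_below[of n]]) blast
    show "inv_poly (m b) (inv_poly (m b) g) = g" if "g \<in> S" for b g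
      using that inv_poly_inv_poly[OF m(1)] by (simp add: S_def m(2))
    show "inv_poly (m b) g \<noteq> g" if "g \<in> S" for b g
      using that inv_poly_neq[OF m(1)] by (simp add: S_def m(2))
  qed (fact chain_Suc chain_mem)+
  then obtain k where k: "k > 0" "even k" "inv_chain f1 f2 a k = a"
    "inj_on (inv_chain f1 f2 a) {0..<k}"
    by auto
  have "k \<ge> 4" if "f1 \<noteq> f2"
  proof (rule ccontr)
    assume "\<not> k \<ge> 4"
    then have "k = 2"
      using k(1,2) by (cases "k = 1 \<or> k = 3") auto
    then have "inv_poly f2 (inv_poly f1 a) = a"
      using k(3) by (simp add: numeral_2_eq_2)
    moreover have "inv_poly f1 a \<in> S"
      using inv_mem[of a False] chain_mem[of 0] by (simp add: m_def)
    then have "inv_poly f2 (inv_poly f2 (inv_poly f1 a)) = inv_poly f1 a"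
      using assms by (intro inv_poly_inv_poly) (auto simp: S_def)
    ultimately have "inv_poly f1 a = inv_poly f2 a"
      by simp
    then show False
      using inv_poly_neq_inv_poly[of f1 f2 a] assms that by simp
  qed
  then show ?thesis
    using k by blast
qed

end
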